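(* The function $\omega:(\Delta(\mathcal{S}(\mathbb{R}_+),\star),\tau^* )\to\mathbb{R}$, where $\omega(m)$ is the unique $s\in\mathbb{R}$ such that $m(f)=\int_0^\infty x^{s-1}f(x)\,dx$ for all $f\in\mathcal{S}(\mathbb{R}_+)$, is an open map (where $\mathbb{R}$ has its standard topology).
   Context: $\mathbb{R}_+=(0,\infty)$, $\mathbb{N}_0=\{0,1,2,\ldots\}$. $\mathcal{S}(\mathbb{R}_+)$ is the real vector space of all $f\in C^\infty(\mathbb{R}_+)$ (real-valued) such that for all $\alpha\in\mathbb{Z}$ and $\beta\in\mathbb{N}_0$ one has $p_{\alpha,\beta}(f) := \sup_{x\in\mathbb{R}_+} |x^\alpha f^{(\beta)}(x)| < \infty$, with the locally convex topology generated by the seminorms $(p_{\alpha,\beta})_{\alpha\in\mathbb{Z},\beta\in\mathbb{N}_0}$. The Mellin convolution of $f,g\in\mathcal{S}(\mathbb{R}_+)$ is the element $f\star g\in\mathcal{S}(\mathbb{R}_+)$ given by $f\star g(x):=\int_0^\infty y^{-1}f(xy^{-1})g(y)\,dy$. The structure space $\Delta(\mathcal{S}(\mathbb{R}_+),\star)$ is the set of all nonzero, linear, continuous functionals $m:\mathcal{S}(\mathbb{R}_+)\to\mathbb{R}$ with $m(f\star g)=m(f)m(g)$ for all $f,g\in\mathcal{S}(\mathbb{R}_+)$. For $s\in\mathbb{R}$ put $m_s(f):=\int_0^\infty x^{s-1}f(x)\,dx$; every $m_s$ belongs to $\Delta(\mathcal{S}(\mathbb{R}_+),\star)$ and every $m\in\Delta(\mathcal{S}(\mathbb{R}_+),\star)$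 equals $m_s$ for a unique $s\in\mathbb{R}$, so $\omega$ is a well-defined bijection. $\tau^*$ is the weak* topology on $\Delta(\mathcal{S}(\mathbb{R}_+),\star)$, i.e. the coarsest topology making all evaluation maps $m\mapsto m(f)$, $f\in\mathcal{S}(\mathbb{R}_+)$, continuous. *)

theory Defs
  imports "HOL-Analysis.Analysis"
begin

text \<open>Functions on the open half-line \<open>{0<..}\<close> are represented by their extension by zero to
  all of \<^typ>\<open>real\<close>, so that equality in \<open>schwartz_pos\<close> is equality on \<open>{0<..}\<close>.  At \<open>x > 0\<close> the
  iterated derivative depends only on the values on \<open>{0<..}\<close>.\<close>

definition schwartz_pos :: "(real \<Rightarrow> real) set" where
  "schwartz_pos = {f.
     (\<forall>x\<le>0. f x = 0) \<and>
     (\<forall>n. (deriv ^^ n) f differentiable_on {0<..}) \<and>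
     (\<forall>(\<alpha>::int) (\<beta>::nat). bdd_above ((\<lambda>x. \<bar>x powi \<alpha> * (deriv ^^ \<beta>) f x\<bar>) ` {0<..}))}"

definition schwartz_pos_seminorm :: "int \<Rightarrow> nat \<Rightarrow> (real \<Rightarrow> real) \<Rightarrow> real" where
  "schwartz_pos_seminorm \<alpha> \<beta> f = (SUP x\<in>{0<..}. \<bar>x powi \<alpha> * (deriv ^^ \<beta>) f x\<bar>)"

definition schwartz_pos_topology :: "(real \<Rightarrow> real) topology" where
  "schwartz_pos_topology = topology_generated_by
     {{g \<in> schwartz_pos. schwartz_pos_seminorm \<alpha> \<beta> (\<lambda>x. g x - f x) < e} | f \<alpha> \<beta> e.
        f \<in> schwartz_pos \<and> 0 < e}"

definition mellin_conv :: "(real \<Rightarrow> real) \<Rightarrow> (real \<Rightarrow> real) \<Rightarrow> real \<Rightarrow> real" where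
  "mellin_conv f g x =
     (if 0 < x then LBINT y:{0<..}. inverse y * f (x * inverse y) * g y else 0)"

text \<open>Functionals on \<open>schwartz_pos\<close> are \<^const>\<open>extensional\<close> there, so that two of them are equal
  iff they agree on \<open>schwartz_pos\<close>.\<close>

definition mellin_structure_space :: "((real \<Rightarrow> real) \<Rightarrow> real) set" where
  "mellin_structure_space = {m \<in> extensional schwartz_pos.
     (\<exists>f\<in>schwartz_pos. m f \<noteq> 0) \<and>
     (\<forall>f\<in>schwartz_pos. \<forall>g\<in>schwartz_pos. m (\<lambda>x. f x + g x) = m f + m g) \<and>
     (\<forall>c. \<forall>f\<in>schwartz_pos. m (\<lambda>x. c * f x) = c * m f) \<and>
     continuous_map schwartz_pos_topology euclideanreal m \<and>
     (\<forall>f\<in>schwartz_pos. \<forall>g\<in>schwartz_pos. m (mellin_conv f g) = m f * m g)}"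

definition mellin_weak_star :: "((real \<Rightarrow> real) \<Rightarrow> real) topology" where
  "mellin_weak_star = topology_generated_by
     {{m \<in> mellin_structure_space. m f \<in> U} | f U. f \<in> schwartz_pos \<and> open U}"

definition mellin_omega :: "((real \<Rightarrow> real) \<Rightarrow> real) \<Rightarrow> real" where
  "mellin_omega m =
     (THE s. \<forall>f\<in>schwartz_pos. m f = (LBINT x:{0<..}. x powr (s - 1) * f x))"

lemma zero_in_schwartz_pos: "(\<lambda>x. 0) \<in> schwartz_pos"
proof -
  have "(deriv ^^ n) (\<lambda>x. 0::real) = (\<lambda>x. 0)" for n
    by (induction n) auto
  then show ?thesis
    by (auto simp: schwartz_pos_def intro!: bdd_aboveI2[where M = 0])
qed

lemma topspace_schwartz_pos_topology: "topspace schwartz_pos_topology = schwartz_pos"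
proof -
  have "g \<in> {h \<in> schwartz_pos. schwartz_pos_seminorm 0 0 (\<lambda>x. h x - g x)
              < \<bar>schwartz_pos_seminorm 0 0 (\<lambda>x. g x - g x)\<bar> + 1}"
    if "g \<in> schwartz_pos" for g
    using that by auto
  moreover have "0 < \<bar>schwartz_pos_seminorm 0 0 (\<lambda>x. g x - g x)\<bar> + 1" for g
    by linarith
  ultimately show ?thesis
    unfolding schwartz_pos_topology_def topology_generated_by_topspace by blast
qed

lemma topspace_mellin_weak_star: "topspace mellin_weak_star = mellin_structure_space"
proof -
  have "m \<in> {m \<in> mellin_structure_space. m (\<lambda>x. 0) \<in> UNIV}"
    if "m \<in> mellin_structure_space" for m
    using that by simp
  then show ?thesis
    unfolding mellin_weak_star_def topology_generated_by_topspace
    using zero_in_schwartz_pos open_UNIV by blast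
qed

end

theory Submission
  imports Defs
begin

text \<open>
Write \<open>m\<^sub>s\<close> for the functional \<open>f \<mapsto> \<integral> x powr (s - 1) * f x\<close> on \<^const>\<open>schwartz_pos\<close>.  The map
\<^const>\<open>mellin_omega\<close> is open because it has a continuous inverse \<open>s \<mapsto> m\<^sub>s\<close>: the image of a weak*
open set \<open>U\<close> is \<open>{s. m\<^sub>s \<in> U}\<close>, and continuity of \<open>s \<mapsto> m\<^sub>s\<close> in the weak* topology means that
\<open>s \<mapsto> m\<^sub>s f\<close> is continuous for each \<open>f\<close>, which is dominated convergence (\<open>mellin_continuous\<close>).
For this inverse to exist, every \<open>m\<^sub>s\<close> must be a character, every character must be some \<open>m\<^sub>s\<close>, and
\<open>s\<close> must be unique.

That \<open>m\<^sub>s\<close> is multiplicative is Fubini's theorem, once convolution is known to preserve the Schwartz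
space (\<open>mellin_conv_schwartz_pos\<close>, \<open>mellin_mellin_conv\<close>).

That every character \<open>m\<close> is some \<open>m\<^sub>s\<close> (\<open>structure_space_representation\<close>) is proved infinitesimally.
Instead of the action of dilations on \<open>m\<close>, the proof uses their generator, the Euler operator
\<open>D f = x f'\<close>.  Integration by parts gives \<open>D f \<star> g = f \<star> D g\<close>, hence \<open>m (D f) m g = m f m (D g)\<close>,
so that \<open>m \<circ> D = - s m\<close> for some real \<open>s\<close>.  Thus \<open>m\<close> vanishes on the range of \<open>D + s\<close>.  That range
contains the kernel of \<open>m\<^sub>s\<close>, since the differential equation \<open>x f' + s f = g\<close> can be solved within
the Schwartz space when \<open>m\<^sub>s g = 0\<close> (\<open>mellin_zero_imp_euler_image\<close>).  Therefore \<open>m\<close> is a multiple of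
\<open>m\<^sub>s\<close>, and multiplicativity makes the factor \<open>1\<close>.  The argument is algebraic apart from the
differential equation, so no vector-valued integrals occur.  The same eigenvalue identity,
\<open>m\<^sub>s \<circ> D = - s m\<^sub>s\<close>, shows that \<open>s\<close> is unique (\<open>mellin_eq_imp_eq\<close>).
\<close>

section \<open>The Schwartz space of the half-line\<close>

text \<open>Faster than polynomial decay at both ends of the half-line: \<open>t\<close> may be large of either sign.  Real
exponents are no stronger than the integer exponents in the seminorms (\<open>powr_le_sum\<close>), and they
make the condition visibly stable under multiplication by \<open>x powr a\<close>.\<close>

definition rapid :: "(real \<Rightarrow> real) \<Rightarrow> bool" where
  "rapid f \<longleftrightarrow> (\<forall>x\<le>0. f x = 0) \<and> (\<forall>t. \<exists>C. \<forall>x>0. x powr t * \<bar>f x\<bar> \<le> C)"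

lemma rapid_bound:
  assumes "rapid f"
  obtains C where "C \<ge> 0" "\<And>x. x > 0 \<Longrightarrow> x powr t * \<bar>f x\<bar> \<le> C"
proof -
  obtain C where C: "\<forall>x>0. x powr t * \<bar>f x\<bar> \<le> C"
    using assms unfolding rapid_def by blast
  have "0 \<le> 1 powr t * \<bar>f 1\<bar>" by simp
  also have "\<dots> \<le> C" using C by (metis zero_less_one)
  finally show ?thesis using C that by blast
qed

text \<open>Since \<open>\<bar>f y\<bar> \<le> C y\<^sup>2\<close> near \<open>0\<close>, the extension by zero is differentiable there.  Hence elements of
\<^const>\<open>schwartz_pos\<close> are differentiable, continuous and Borel measurable on the whole line, and
their derivatives again vanish off the half-line; no set restriction has to be carried around.\<close>

lemma rapid_DERIV_nonpos:
  assumes f: "rapid f" and "x \<le> 0"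
  shows "(f has_real_derivative 0) (at x)"
proof (cases "x = 0")
  case False
  then have "x < 0" using assms by simp
  have "((\<lambda>_. 0) has_real_derivative 0) (at x)" by simp
  then show ?thesis
    by (rule DERIV_cong_ev[THEN iffD1, rotated -1])
       (use f \<open>x < 0\<close> in \<open>auto simp: rapid_def eventually_nhds intro!: exI[of _ "{..<0}"]\<close>)
next
  case True
  obtain C where C: "C \<ge> 0" "\<And>y. y > 0 \<Longrightarrow> y powr (-2) * \<bar>f y\<bar> \<le> C"
    using rapid_bound[OF f] by metis
  have bd: "\<bar>f y / y\<bar> \<le> C * \<bar>y\<bar>" if "y \<noteq> 0" for y
  proof (cases "y > 0")
    case True
    then have "\<bar>f y\<bar> = y^2 * (y powr (-2) * \<bar>f y\<bar>)"
      by (simp add: powr_minus field_simps powr_realpow)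
    also have "\<dots> \<le> y^2 * C" by (intro mult_left_mono C True) auto
    finally show ?thesis using True by (simp add: field_simps power2_eq_square)
  next
    case False
    then have "f y / y = 0" using f by (simp add: rapid_def)
    then have "f y = 0" by (simp add: that)
    then show ?thesis using C(1) by simp
  qed
  have "((\<lambda>y. f y / y) \<longlongrightarrow> 0) (at 0)"
  proof (rule Lim_null_comparison)
    show "\<forall>\<^sub>F y in at 0. norm (f y / y) \<le> C * \<bar>y\<bar>"
      using bd by (auto simp: eventually_at_filter)
    show "((\<lambda>y. C * \<bar>y\<bar>) \<longlongrightarrow> 0) (at 0)"
      by (auto intro!: tendsto_eq_intros)
  qed
  then show ?thesis
    using True f by (simp add: has_field_derivative_iff rapid_def)
qed

text \<open>\<^const>\<open>schwartz_pos\<close> is the largest family of rapidly decaying differentiable functions that is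
closed under \<^const>\<open>deriv\<close>.  Membership proofs thus never compute a higher derivative: it is enough
to find a closed family that contains the function.\<close>

lemma schwartz_pos_coinduct:
  assumes rapid: "\<And>f. f \<in> F \<Longrightarrow> rapid f"
    and diff: "\<And>f x. f \<in> F \<Longrightarrow> 0 < x \<Longrightarrow> f differentiable at x"
    and deriv: "\<And>f. f \<in> F \<Longrightarrow> deriv f \<in> F"
    and f: "f \<in> F"
  shows "f \<in> schwartz_pos"
proof -
  have F: "(deriv ^^ n) f \<in> F" for n
    by (induction n) (use f deriv in auto)
  have "bdd_above ((\<lambda>x. \<bar>x powi \<alpha> * (deriv ^^ \<beta>) f x\<bar>) ` {0<..})" for \<alpha> \<beta>
  proof -
    obtain C where "\<And>x. x > 0 \<Longrightarrow> x powr of_int \<alpha> * \<bar>(deriv ^^ \<beta>) f x\<bar> \<le> C"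
      using rapid_bound[OF rapid[OF F]] by metis
    then show ?thesis
      by (intro bdd_aboveI2[where M = C]) (auto simp: abs_mult powr_real_of_int')
  qed
  moreover have "(deriv ^^ n) f differentiable_on {0<..}" for n
    using diff[OF F] by (auto simp: differentiable_on_def intro: differentiable_at_withinI)
  ultimately show ?thesis
    using rapid[OF f] by (auto simp: schwartz_pos_def rapid_def)
qed

lemma powr_le_sum:
  assumes "a \<le> t" "t \<le> b" "0 < (x::real)"
  shows "x powr t \<le> x powr a + x powr b"
proof (cases "x \<le> 1")
  case True
  then have "x powr t \<le> x powr a" using assms by (intro powr_mono') auto
  then show ?thesis by (simp add: add_increasing2)
next
  case False
  then have "x powr t \<le> x powr b" using assms by (intro powr_mono) auto
  then show ?thesis by (simp add: add_increasing)
qed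

lemma
  assumes "f \<in> schwartz_pos"
  shows schwartz_pos_nonpos: "x \<le> 0 \<Longrightarrow> f x = 0"
    and schwartz_pos_differentiable: "(deriv ^^ n) f differentiable_on {0<..}"
    and schwartz_pos_bdd: "bdd_above ((\<lambda>x. \<bar>x powi \<alpha> * (deriv ^^ \<beta>) f x\<bar>) ` {0<..})"
proof -
  have *: "(\<forall>x\<le>0. f x = 0) \<and> (\<forall>n. (deriv ^^ n) f differentiable_on {0<..}) \<and>
     (\<forall>\<alpha> \<beta>. bdd_above ((\<lambda>x. \<bar>x powi \<alpha> * (deriv ^^ \<beta>) f x\<bar>) ` {0<..}))"
    using assms unfolding schwartz_pos_def by (rule CollectD)
  show "x \<le> 0 \<Longrightarrow> f x = 0" using * by simp
  show "(deriv ^^ n) f differentiable_on {0<..}"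
    by (rule spec[OF conjunct1[OF conjunct2[OF *]]])
  show "bdd_above ((\<lambda>x. \<bar>x powi \<alpha> * (deriv ^^ \<beta>) f x\<bar>) ` {0<..})"
    by (rule spec[OF spec[OF conjunct2[OF conjunct2[OF *]]]])
qed

lemma schwartz_pos_rapid:
  assumes f: "f \<in> schwartz_pos"
  shows "rapid f"
  unfolding rapid_def
proof (intro conjI allI)
  fix t :: real
  have "\<exists>C. \<forall>x>0. x powr of_int \<alpha> * \<bar>f x\<bar> \<le> C" for \<alpha> :: int
  proof -
    show ?thesis
      using schwartz_pos_bdd[OF f, of \<alpha> 0]
      by (auto simp: bdd_above_def abs_mult powr_real_of_int')
  qed
  then obtain C1 C2 where C: "\<forall>x>0. x powr of_int \<lfloor>t\<rfloor> * \<bar>f x\<bar> \<le> C1"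
      "\<forall>x>0. x powr of_int \<lceil>t\<rceil> * \<bar>f x\<bar> \<le> C2" by meson
  have "x powr t * \<bar>f x\<bar> \<le> C1 + C2" if "x > 0" for x
  proof -
    have "x powr t * \<bar>f x\<bar> \<le> (x powr of_int \<lfloor>t\<rfloor> + x powr of_int \<lceil>t\<rceil>) * \<bar>f x\<bar>"
      by (intro mult_right_mono powr_le_sum that) auto
    also have "\<dots> \<le> C1 + C2"
      using C that by (simp add: distrib_right add_mono)
    finally show ?thesis .
  qed
  then show "\<exists>C. \<forall>x>0. x powr t * \<bar>f x\<bar> \<le> C" by blast
qed (use f in \<open>auto simp: schwartz_pos_def\<close>)

lemma schwartz_pos_DERIV:
  assumes f: "f \<in> schwartz_pos"
  shows "(f has_real_derivative deriv f x) (at x)"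
proof (cases "x > 0")
  case True
  have "f differentiable at x within {0<..}"
    using schwartz_pos_differentiable[OF f, of 0] True by (auto simp: differentiable_on_def)
  then have "f differentiable at x"
    using True at_within_open[of x "{0<..}"] by simp
  then show ?thesis
    by (rule DERIV_deriv_iff_real_differentiable[THEN iffD2])
next
  case False
  then have "(f has_real_derivative 0) (at x)"
    using rapid_DERIV_nonpos[OF schwartz_pos_rapid[OF f]] by simp
  then show ?thesis using DERIV_imp_deriv[of f 0 x] by simp
qed

lemma schwartz_pos_deriv:
  assumes f: "f \<in> schwartz_pos"
  shows "deriv f \<in> schwartz_pos"
proof -
  have eq: "(deriv ^^ n) (deriv f) = (deriv ^^ Suc n) f" for n
    by (simp add: funpow_swap1)
  have "deriv f x = 0" if "x \<le> 0" for x
    by (rule DERIV_imp_deriv[OF rapid_DERIV_nonpos[OF schwartz_pos_rapid[OF f] that]])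
  then show ?thesis
    unfolding schwartz_pos_def mem_Collect_eq unfolding eq
    by (intro conjI allI impI) (assumption | rule schwartz_pos_differentiable[OF f] schwartz_pos_bdd[OF f])+
qed

lemma rapid_add:
  assumes "rapid f" "rapid g"
  shows "rapid (\<lambda>x. f x + g x)"
  unfolding rapid_def
proof (intro conjI allI)
  fix t
  obtain C where C: "\<And>x. x > 0 \<Longrightarrow> x powr t * \<bar>f x\<bar> \<le> C"
    using rapid_bound[OF assms(1)] by metis
  obtain D where D: "\<And>x. x > 0 \<Longrightarrow> x powr t * \<bar>g x\<bar> \<le> D"
    using rapid_bound[OF assms(2)] by metis
  have "x powr t * \<bar>f x + g x\<bar> \<le> C + D" if "x > 0" for x
  proof -
    have "x powr t * \<bar>f x + g x\<bar> \<le> x powr t * \<bar>f x\<bar> + x powr t * \<bar>g x\<bar>"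
      by (simp add: distrib_left[symmetric] mult_left_mono)
    then show ?thesis using C[OF that] D[OF that] by linarith
  qed
  then show "\<exists>C. \<forall>x>0. x powr t * \<bar>f x + g x\<bar> \<le> C" by blast
qed (use assms in \<open>auto simp: rapid_def\<close>)

lemma rapid_powr_mult:
  assumes "rapid f"
  shows "rapid (\<lambda>x. c * x powr a * f x)"
  unfolding rapid_def
proof (intro conjI allI)
  fix t
  obtain C where C: "\<And>x. x > 0 \<Longrightarrow> x powr (t + a) * \<bar>f x\<bar> \<le> C"
    using rapid_bound[OF assms(1)] by metis
  have "x powr t * \<bar>c * x powr a * f x\<bar> \<le> \<bar>c\<bar> * C" if "x > 0" for x
    using mult_left_mono[OF C[OF that], of "\<bar>c\<bar>"] that
    by (simp add: abs_mult powr_add algebra_simps)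
  then show "\<exists>C. \<forall>x>0. x powr t * \<bar>c * x powr a * f x\<bar> \<le> C" by blast
qed (use assms in \<open>auto simp: rapid_def\<close>)


text \<open>The derivative of \<open>x powr t * f x\<close> is a sum of two functions of the same shape, so these products
alone are not closed under differentiation, but their sums are.\<close>

inductive_set powr_span :: "(real \<Rightarrow> real) set" where
  powr_span_base: "f \<in> schwartz_pos \<Longrightarrow> (\<lambda>x. c * x powr t * f x) \<in> powr_span"
| powr_span_add: "f \<in> powr_span \<Longrightarrow> g \<in> powr_span \<Longrightarrow> (\<lambda>x. f x + g x) \<in> powr_span"

lemma rapid_powr_span: "f \<in> powr_span \<Longrightarrow> rapid f"
proof (induction rule: powr_span.induct)
  case (powr_span_base f c t)
  then show ?case by (intro rapid_powr_mult schwartz_pos_rapid)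
next
  case (powr_span_add f g)
  then show ?case by (intro rapid_add)
qed

lemma powr_span_deriv:
  assumes "f \<in> powr_span"
  shows "\<exists>f'\<in>powr_span. \<forall>x. (f has_real_derivative f' x) (at x)"
  using assms
proof (induction rule: powr_span.induct)
  case (powr_span_base f c t)
  let ?h = "\<lambda>x. c * t * x powr (t - 1) * f x + c * x powr t * deriv f x"
  have "((\<lambda>x. c * x powr t * f x) has_real_derivative ?h x) (at x)" for x
  proof (cases "x > 0")
    case True
    then show ?thesis
      by (auto intro!: derivative_eq_intros schwartz_pos_DERIV[OF powr_span_base])
  next
    case False
    moreover have "?h x = 0"
      using False powr_span_base by (simp add: schwartz_pos_nonpos schwartz_pos_deriv)
    ultimately show ?thesis
      using rapid_DERIV_nonpos[of "\<lambda>x. c * x powr t * f x" x]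
      by (simp add: rapid_powr_mult schwartz_pos_rapid powr_span_base)
  qed
  moreover have "?h \<in> powr_span"
    by (intro powr_span.intros schwartz_pos_deriv powr_span_base)
  ultimately show ?case by (intro bexI[of _ ?h] allI)
next
  case (powr_span_add f g)
  then obtain f' g' where "f' \<in> powr_span" "g' \<in> powr_span"
     "\<forall>x. (f has_real_derivative f' x) (at x)" "\<forall>x. (g has_real_derivative g' x) (at x)"
    by (elim bexE)
  then show ?case
    by (intro bexI[of _ "\<lambda>x. f' x + g' x"] allI DERIV_add powr_span.powr_span_add) simp_all
qed

lemma schwartz_pos_eq_powr_span: "schwartz_pos = powr_span"
proof (intro set_eqI iffI)
  fix f assume f: "f \<in> schwartz_pos"
  then have "(\<lambda>x. 1 * x powr 0 * f x) = f"
    by (auto simp: fun_eq_iff schwartz_pos_nonpos)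
  then show "f \<in> powr_span"
    using powr_span.powr_span_base[OF f] by metis
next
  fix f assume "f \<in> powr_span"
  then show "f \<in> schwartz_pos"
  proof (rule schwartz_pos_coinduct[rotated 3])
    fix f x assume "f \<in> powr_span"
    from powr_span_deriv[OF this]
    obtain f' where f': "f' \<in> powr_span" "\<forall>x. (f has_real_derivative f' x) (at x)"
      by (elim bexE)
    then show "f differentiable at x"
      unfolding real_differentiable_def by (intro exI[of _ "f' x"]) simp
    have "deriv f = f'" using f'(2) by (intro ext DERIV_imp_deriv) simp
    then show "deriv f \<in> powr_span" using f' by simp
  qed (rule rapid_powr_span)
qed

lemma schwartz_pos_add:
  "f \<in> schwartz_pos \<Longrightarrow> g \<in> schwartz_pos \<Longrightarrow> (\<lambda>x. f x + g x) \<in> schwartz_pos"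
  unfolding schwartz_pos_eq_powr_span by (rule powr_span.powr_span_add)

lemma schwartz_pos_powr_mult:
  "f \<in> schwartz_pos \<Longrightarrow> (\<lambda>x. x powr t * f x) \<in> schwartz_pos"
  using powr_span.powr_span_base[of f 1 t] schwartz_pos_eq_powr_span by simp

lemma schwartz_pos_scale:
  assumes "f \<in> schwartz_pos"
  shows "(\<lambda>x. c * f x) \<in> schwartz_pos"
proof -
  have "(\<lambda>x. c * x powr 0 * f x) = (\<lambda>x. c * f x)"
    using assms by (auto simp: fun_eq_iff schwartz_pos_nonpos)
  then show ?thesis
    using powr_span.powr_span_base[OF assms, of c 0] schwartz_pos_eq_powr_span by simp
qed

lemma schwartz_pos_diff:
  assumes "f \<in> schwartz_pos" "g \<in> schwartz_pos"
  shows "(\<lambda>x. f x - g x) \<in> schwartz_pos"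
proof -
  have "(\<lambda>x. f x + (-1) * g x) \<in> schwartz_pos"
    by (rule schwartz_pos_add[OF assms(1) schwartz_pos_scale[OF assms(2)]])
  then show ?thesis by simp
qed

section \<open>Integrals and primitives\<close>

lemma integrable_halfline_kernel:
  "integrable lborel (\<lambda>x::real. indicator {0..} x * inverse (1 + x\<^sup>2))"
proof -
  have pos: "0 < 1 + x\<^sup>2" for x :: real
    by (simp add: add_pos_nonneg)
  have "(\<integral>\<^sup>+x. ennreal (inverse (1 + x\<^sup>2)) * indicator {0..} x \<partial>lborel) = pi / 2 - arctan 0"
    by (rule nn_integral_FTC_atLeast[where F = arctan])
       (auto intro!: DERIV_arctan tendsto_arctan_at_top simp: pos less_imp_le)
  moreover have "ennreal (indicator {0..} x * inverse (1 + x\<^sup>2))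
      = ennreal (inverse (1 + x\<^sup>2)) * indicator {0..} x" for x :: real
    by (simp split: split_indicator)
  ultimately have "(\<integral>\<^sup>+x. ennreal (indicator {0..} x * inverse (1 + x\<^sup>2)) \<partial>lborel) < \<infinity>"
    by simp
  then show ?thesis
    by (intro integrableI_nonneg) (auto simp: pos less_imp_le)
qed

definition kernel_mass :: real where
  "kernel_mass = (\<integral>x. indicator {0..} x * inverse (1 + x\<^sup>2) \<partial>lborel)"

lemma kernel_mass_nonneg: "0 \<le> kernel_mass"
  unfolding kernel_mass_def by (intro integral_nonneg_AE) (simp add: add_nonneg_nonneg)

lemma schwartz_pos_continuous: "f \<in> schwartz_pos \<Longrightarrow> isCont f x"
  using schwartz_pos_DERIV DERIV_isCont by blast

lemma schwartz_pos_measurable: "f \<in> schwartz_pos \<Longrightarrow> f \<in> borel_measurable borel"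
  by (intro borel_measurable_continuous_onI continuous_at_imp_continuous_on)
     (auto intro: schwartz_pos_continuous)

text \<open>The estimate is quantitative because the continuity of the Mellin functionals rests on it.\<close>

lemma
  assumes meas: "f \<in> borel_measurable borel"
    and zero: "\<And>x. x \<le> 0 \<Longrightarrow> f x = 0"
    and bound: "\<And>x. 0 < x \<Longrightarrow> (1 + x\<^sup>2) * \<bar>f x\<bar> \<le> C"
  shows integrable_quadratic_decay: "integrable lborel f"
    and integral_quadratic_decay_le: "\<bar>\<integral>x. f x \<partial>lborel\<bar> \<le> C * kernel_mass"
proof -
  let ?k = "\<lambda>x::real. C * (indicator {0..} x * inverse (1 + x\<^sup>2))"
  have bd: "\<bar>f x\<bar> \<le> ?k x" for x
  proof (cases "0 < x")
    case True
    then show ?thesis using bound[OF True]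
      by (simp add: field_simps add_pos_nonneg)
  next
    case False
    have "0 \<le> C" using bound[of 1] by (smt (verit) mult_nonneg_nonneg zero_le_power2 abs_ge_zero)
    then show ?thesis using False zero by simp
  qed
  have k: "integrable lborel ?k" using integrable_halfline_kernel by simp
  show int: "integrable lborel f"
    by (rule Bochner_Integration.integrable_bound[OF k]) (use meas bd in \<open>auto intro: order_trans[OF _ abs_ge_self]\<close>)
  have "\<bar>\<integral>x. f x \<partial>lborel\<bar> \<le> (\<integral>x. \<bar>f x\<bar> \<partial>lborel)" by (rule integral_abs_bound)
  also have "\<dots> \<le> (\<integral>x. ?k x \<partial>lborel)"
    by (intro integral_mono integrable_abs int k bd)
  finally show "\<bar>\<integral>x. f x \<partial>lborel\<bar> \<le> C * kernel_mass"
    by (simp add: kernel_mass_def)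
qed

lemma schwartz_pos_integrable:
  assumes f: "f \<in> schwartz_pos"
  shows "integrable lborel f"
proof -
  obtain C where C: "\<And>x. x > 0 \<Longrightarrow> x powr 0 * \<bar>f x\<bar> \<le> C"
    using rapid_bound[OF schwartz_pos_rapid[OF f]] by metis
  obtain D where D: "\<And>x. x > 0 \<Longrightarrow> x powr 2 * \<bar>f x\<bar> \<le> D"
    using rapid_bound[OF schwartz_pos_rapid[OF f]] by metis
  show ?thesis
  proof (rule integrable_quadratic_decay[where C = "C + D"])
    show "(1 + x\<^sup>2) * \<bar>f x\<bar> \<le> C + D" if "0 < x" for x
      using C[OF that] D[OF that] that by (simp add: distrib_right)
  qed (use f in \<open>auto simp: schwartz_pos_measurable schwartz_pos_nonpos\<close>)
qed

lemma schwartz_pos_bounded: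
  assumes f: "f \<in> schwartz_pos"
  obtains C where "0 \<le> C" "\<And>x. \<bar>f x\<bar> \<le> C"
proof -
  obtain C where C: "0 \<le> C" "\<And>x. x > 0 \<Longrightarrow> x powr 0 * \<bar>f x\<bar> \<le> C"
    using rapid_bound[OF schwartz_pos_rapid[OF f]] by metis
  have "\<bar>f x\<bar> \<le> C" for x
    using C f by (cases "x > 0") (auto simp: schwartz_pos_nonpos)
  then show ?thesis using that C by blast
qed

lemma integrable_bounded_mult_schwartz_pos:
  assumes f: "f \<in> schwartz_pos" and b: "b \<in> borel_measurable borel" "\<And>x. \<bar>b x\<bar> \<le> C"
  shows "integrable lborel (\<lambda>x. b x * f x)"
proof (rule Bochner_Integration.integrable_bound)
  show "integrable lborel (\<lambda>x. C * f x)" using schwartz_pos_integrable[OF f] by simp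
  have "\<bar>b x\<bar> \<le> \<bar>C\<bar>" for x using b(2)[of x] by linarith
  then show "AE x in lborel. norm (b x * f x) \<le> norm (C * f x)"
    by (auto simp: abs_mult intro!: mult_right_mono)
qed (use b f schwartz_pos_measurable in auto)

definition mellin :: "real \<Rightarrow> (real \<Rightarrow> real) \<Rightarrow> real" where
  "mellin s f = (LBINT x:{0<..}. x powr (s - 1) * f x)"

lemma mellin_eq_integral:
  assumes "f \<in> schwartz_pos"
  shows "mellin s f = (\<integral>x. x powr (s - 1) * f x \<partial>lborel)"
  unfolding mellin_def set_lebesgue_integral_def
  by (intro Bochner_Integration.integral_cong) (auto simp: schwartz_pos_nonpos[OF assms] indicator_def)

lemma rapid_tendsto_0_at_top:
  assumes "rapid h" shows "(h \<longlongrightarrow> 0) at_top"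
proof -
  obtain C where C: "\<And>x. x > 0 \<Longrightarrow> x powr 1 * \<bar>h x\<bar> \<le> C" using rapid_bound[OF assms] by metis
  show ?thesis
  proof (rule Lim_null_comparison)
    show "\<forall>\<^sub>F x in at_top. norm (h x) \<le> C / x"
      using eventually_gt_at_top[of 0]
      by eventually_elim (use C in \<open>simp add: field_simps\<close>)
    show "((\<lambda>x. C / x) \<longlongrightarrow> 0) at_top"
      by (intro real_tendsto_divide_at_top[OF tendsto_const] filterlim_ident)
  qed
qed

text \<open>This is the source of every integration by parts below: the boundary terms vanish at both ends.
Continuity of \<open>h'\<close> is required on the open half-line only, because the products \<open>f (x / y) * g y\<close>
to which it is applied are awkward at \<open>y = 0\<close>.\<close>

lemma integral_derivative_rapid:
  assumes h: "rapid h"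
    and deriv: "\<And>x. 0 < x \<Longrightarrow> (h has_real_derivative h' x) (at x)"
    and cont: "\<And>x. 0 < x \<Longrightarrow> isCont h' x"
    and int: "integrable lborel h'"
    and zero: "\<And>x. x \<le> 0 \<Longrightarrow> h' x = 0"
  shows "(\<integral>x. h' x \<partial>lborel) = 0"
proof -
  have eq: "indicator {0<..} x * h' x = h' x" for x
    using zero by (simp split: split_indicator)
  have "isCont h 0" using rapid_DERIV_nonpos[OF h, of 0] DERIV_isCont by blast
  then have h0: "(h \<longlongrightarrow> 0) (at_right 0)"
    using h by (auto simp: isCont_def rapid_def intro: tendsto_within_subset)
  have "(LBINT x=0..\<infinity>. h' x) = 0 - 0"
  proof (rule interval_integral_FTC_integrable[where F = h])
    show "set_integrable lborel (einterval 0 \<infinity>) h'"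
      using int by (simp add: set_integrable_def eq zero_ereal_def)
  qed (use h0 rapid_tendsto_0_at_top[OF h] deriv cont in
        \<open>auto simp: has_real_derivative_iff_has_vector_derivative[symmetric] ereal_tendsto_simps zero_ereal_def\<close>)
  then show ?thesis
    by (simp add: interval_lebesgue_integral_0_infty set_lebesgue_integral_def eq)
qed

lemma integral_deriv_schwartz_pos:
  assumes f: "f \<in> schwartz_pos"
  shows "(\<integral>x. deriv f x \<partial>lborel) = 0"
  using f by (intro integral_derivative_rapid[of f])
    (auto intro: schwartz_pos_rapid schwartz_pos_DERIV schwartz_pos_continuous schwartz_pos_deriv
       schwartz_pos_integrable schwartz_pos_nonpos)

text \<open>The primitive \<open>F\<close> that vanishes at \<open>0\<close> is the integral of \<open>u\<close> over the part of the line to the left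
of \<open>x\<close>, and, because the total integral is zero, minus the integral over the part to the right.
The first form gives the decay of \<open>F\<close> at \<open>0\<close>, the second the decay at infinity.\<close>

lemma schwartz_pos_primitive:
  assumes u: "u \<in> schwartz_pos" and zero: "(\<integral>x. u x \<partial>lborel) = 0"
  obtains F where "F \<in> schwartz_pos" "\<And>x. (F has_real_derivative u x) (at x)"
proof -
  obtain H where H: "\<And>x. (H has_real_derivative u x) (at x)"
    using einterval_antiderivative[of "-\<infinity>" "\<infinity>" u] schwartz_pos_continuous[OF u]
    by (auto simp: has_real_derivative_iff_has_vector_derivative)
  define F where "F x = H x - H 0" for x
  have F: "(F has_real_derivative u x) (at x)" for x
    unfolding F_def using H by (auto intro!: derivative_eq_intros)
  note cont = schwartz_pos_continuous[OF u]
  have F0: "F x = 0" if "x \<le> 0" for x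
  proof -
    have "(\<integral>y. u y * indicator {x..0} y \<partial>lborel) = F 0 - F x"
      by (rule integral_FTC_Icc_real) (use that F cont in auto)
    moreover have "(\<lambda>y. u y * indicator {x..0} y) = (\<lambda>y. 0)"
      by (simp add: fun_eq_iff schwartz_pos_nonpos[OF u] split: split_indicator)
    ultimately show ?thesis by (simp add: F_def)
  qed
  note int = schwartz_pos_integrable[OF u]
  have below: "F x = (\<integral>y. indicator {..x} y * u y \<partial>lborel)" if "0 < x" for x
  proof -
    have "(\<integral>y. u y * indicator {0..x} y \<partial>lborel) = F x - F 0"
      by (rule integral_FTC_Icc_real) (use that F cont in auto)
    moreover have "(\<lambda>y. u y * indicator {0..x} y) = (\<lambda>y. indicator {..x} y * u y)"
      using that by (auto simp: fun_eq_iff schwartz_pos_nonpos[OF u] split: split_indicator)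
    ultimately show ?thesis by (simp add: F_def)
  qed
  have above: "F x = - (\<integral>y. indicator {x<..} y * u y \<partial>lborel)" if "0 < x" for x
  proof -
    have "(\<integral>y. u y \<partial>lborel) = (\<integral>y. indicator {..x} y * u y + indicator {x<..} y * u y \<partial>lborel)"
      by (intro Bochner_Integration.integral_cong) (auto simp: indicator_def)
    also have "\<dots> = F x + (\<integral>y. indicator {x<..} y * u y \<partial>lborel)"
      unfolding below[OF that]
      using integrable_real_mult_indicator[OF _ int]
      by (intro Bochner_Integration.integral_add) (simp_all add: mult.commute)
    finally show ?thesis using zero by simp
  qed
  have bound: "x powr t * \<bar>\<integral>y. indicator A y * u y \<partial>lborel\<bar> \<le> (\<integral>y. \<bar>y powr t * u y\<bar> \<partial>lborel)"
    if "A \<in> sets borel" "\<And>y. y \<in> A \<Longrightarrow> 0 < y \<Longrightarrow> x powr t \<le> y powr t" for A x t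
  proof -
    have int_A: "integrable lborel (\<lambda>y. indicator A y * u y)"
      using integrable_real_mult_indicator[OF _ int, of A] that by (simp add: mult.commute)
    have "x powr t * \<bar>\<integral>y. indicator A y * u y \<partial>lborel\<bar>
          \<le> x powr t * (\<integral>y. \<bar>indicator A y * u y\<bar> \<partial>lborel)"
      by (intro mult_left_mono integral_abs_bound) auto
    also have "\<dots> = (\<integral>y. x powr t * \<bar>indicator A y * u y\<bar> \<partial>lborel)" by simp
    also have "\<dots> \<le> (\<integral>y. \<bar>y powr t * u y\<bar> \<partial>lborel)"
    proof (intro integral_mono)
      show "integrable lborel (\<lambda>y. \<bar>y powr t * u y\<bar>)"
        by (intro integrable_abs schwartz_pos_integrable schwartz_pos_powr_mult u)
      show "x powr t * \<bar>indicator A y * u y\<bar> \<le> \<bar>y powr t * u y\<bar>" for y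
        using that(2)[of y]
        by (cases "0 < y") (auto simp: indicator_def abs_mult schwartz_pos_nonpos[OF u] intro!: mult_right_mono)
    qed (use int_A in auto)
    finally show ?thesis .
  qed
  \<comment> \<open>A factor \<open>x powr t\<close> moves under the integral sign: for \<open>t \<le> 0\<close> over \<open>y \<le> x\<close>, for \<open>t \<ge> 0\<close> over \<open>y > x\<close>.\<close>
  have "rapid F"
    unfolding rapid_def
  proof (intro conjI allI)
    fix t
    have "x powr t * \<bar>F x\<bar> \<le> (\<integral>y. \<bar>y powr t * u y\<bar> \<partial>lborel)" if "0 < x" for x
    proof (cases "t \<le> 0")
      case True
      then show ?thesis unfolding below[OF that] using that
        by (intro bound) (auto intro: powr_mono2')
    next
      case False
      then show ?thesis unfolding above[OF that] abs_minus_cancel using that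
        by (intro bound) (auto intro: powr_mono2)
    qed
    then show "\<exists>C. \<forall>x>0. x powr t * \<bar>F x\<bar> \<le> C" by blast
  qed (use F0 in auto)
  have dF: "deriv F = u" using DERIV_imp_deriv[OF F] by blast
  have "F \<in> schwartz_pos"
  proof (rule schwartz_pos_coinduct[where F = "insert F schwartz_pos"])
    fix f x assume f: "f \<in> insert F schwartz_pos"
    show "rapid f" using f \<open>rapid F\<close> schwartz_pos_rapid by blast
    show "deriv f \<in> insert F schwartz_pos" using f dF u schwartz_pos_deriv by auto
    show "f differentiable at x"
      using f F schwartz_pos_DERIV real_differentiable_def by blast
  qed simp
  then show ?thesis using that F by blast
qed

section \<open>Mellin convolution\<close>

lemma mellin_conv_eq_integral:
  assumes f: "f \<in> schwartz_pos" and g: "g \<in> schwartz_pos"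
  shows "mellin_conv f g x = (\<integral>y. inverse y * f (x * inverse y) * g y \<partial>lborel)"
proof (cases "0 < x")
  case True
  then show ?thesis
    unfolding mellin_conv_def set_lebesgue_integral_def
    by (auto simp: schwartz_pos_nonpos[OF g] split: split_indicator intro!: Bochner_Integration.integral_cong)
next
  case False
  have zero: "inverse y * f (x * inverse y) * g y = 0" for y
    using False by (cases "0 < y")
      (auto simp: schwartz_pos_nonpos[OF f] schwartz_pos_nonpos[OF g] mult_nonpos_nonneg)
  show ?thesis
    unfolding zero using False by (simp add: mellin_conv_def)
qed

lemma schwartz_pos_inverse_mult:
  assumes "g \<in> schwartz_pos"
  shows "(\<lambda>y. inverse y * g y) \<in> schwartz_pos"
proof -
  have "(\<lambda>y. y powr (-1) * g y) = (\<lambda>y. inverse y * g y)"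
    by (auto simp: fun_eq_iff powr_minus not_less schwartz_pos_nonpos[OF assms] intro: ccontr)
  then show ?thesis using schwartz_pos_powr_mult[OF assms, of "-1"] by simp
qed

lemma measurable_dilation:
  assumes "f \<in> schwartz_pos"
  shows "(\<lambda>y. f (x * inverse y)) \<in> borel_measurable borel"
  using schwartz_pos_measurable[OF assms] by measurable

lemma integrable_mellin_conv:
  assumes f: "f \<in> schwartz_pos" and g: "g \<in> schwartz_pos"
  shows "integrable lborel (\<lambda>y. inverse y * f (x * inverse y) * g y)"
proof -
  obtain C where "\<And>x. \<bar>f x\<bar> \<le> C" using schwartz_pos_bounded[OF f] by metis
  then have "integrable lborel (\<lambda>y. f (x * inverse y) * (inverse y * g y))"
    by (intro integrable_bounded_mult_schwartz_pos[where C = C]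
        schwartz_pos_inverse_mult g measurable_dilation f) auto
  then show ?thesis by (simp add: mult_ac)
qed

text \<open>Multiplication by a power of \<open>x\<close> is an automorphism of the convolution algebra.  It reduces the decay
of a convolution to boundedness, and the multiplicativity of every Mellin functional to that of the
plain integral.\<close>

lemma mellin_conv_powr_mult:
  assumes f: "f \<in> schwartz_pos" and g: "g \<in> schwartz_pos"
  shows "mellin_conv (\<lambda>x. x powr a * f x) (\<lambda>x. x powr a * g x) x = x powr a * mellin_conv f g x"
proof (cases "0 < x")
  case True
  have eq: "inverse y * ((x * inverse y) powr a * f (x * inverse y)) * (y powr a * g y)
     = x powr a * (inverse y * f (x * inverse y) * g y)" for y
  proof (cases "0 < y")
    case y: True
    have "(x * inverse y) powr a * y powr a = x powr a"
      using True y powr_mult[of "x * inverse y" y a] by (simp add: field_simps)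
    then show ?thesis by (metis (no_types, opaque_lifting) mult.assoc mult.commute)
  qed (simp add: schwartz_pos_nonpos[OF g])
  show ?thesis
    by (simp only: mellin_conv_eq_integral schwartz_pos_powr_mult f g eq integral_mult_right_zero)
qed (simp add: mellin_conv_def)

lemma mellin_conv_bounded:
  assumes f: "f \<in> schwartz_pos" and g: "g \<in> schwartz_pos"
  obtains C where "\<And>x. \<bar>mellin_conv f g x\<bar> \<le> C"
proof -
  obtain C where C: "0 \<le> C" "\<And>x. \<bar>f x\<bar> \<le> C" using schwartz_pos_bounded[OF f] by metis
  have "\<bar>mellin_conv f g x\<bar> \<le> (\<integral>y. C * \<bar>inverse y * g y\<bar> \<partial>lborel)" for x
  proof -
    have "\<bar>mellin_conv f g x\<bar> \<le> (\<integral>y. \<bar>inverse y * f (x * inverse y) * g y\<bar> \<partial>lborel)"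
      unfolding mellin_conv_eq_integral[OF f g] by (rule integral_abs_bound)
    also have "\<dots> \<le> (\<integral>y. C * \<bar>inverse y * g y\<bar> \<partial>lborel)"
    proof (intro integral_mono integrable_abs integrable_mult_right integrable_mellin_conv f g
        schwartz_pos_integrable schwartz_pos_inverse_mult)
      show "\<bar>inverse y * f (x * inverse y) * g y\<bar> \<le> C * \<bar>inverse y * g y\<bar>" for y
        using mult_right_mono[OF C(2)[of "x * inverse y"], of "\<bar>inverse y * g y\<bar>"]
        by (simp add: abs_mult mult_ac)
    qed
    finally show ?thesis .
  qed
  then show ?thesis by (rule that)
qed

lemma rapid_mellin_conv:
  assumes f: "f \<in> schwartz_pos" and g: "g \<in> schwartz_pos"
  shows "rapid (mellin_conv f g)"
  unfolding rapid_def
proof (intro conjI allI)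
  fix t
  obtain C where C: "\<And>x. \<bar>mellin_conv (\<lambda>x. x powr t * f x) (\<lambda>x. x powr t * g x) x\<bar> \<le> C"
    using mellin_conv_bounded[OF schwartz_pos_powr_mult[OF f] schwartz_pos_powr_mult[OF g]] by metis
  then have "\<forall>x>0. x powr t * \<bar>mellin_conv f g x\<bar> \<le> C"
    by (simp add: mellin_conv_powr_mult[OF f g] abs_mult)
  then show "\<exists>C. \<forall>x>0. x powr t * \<bar>mellin_conv f g x\<bar> \<le> C" ..
qed (simp add: mellin_conv_def)

lemma schwartz_pos_lipschitz:
  assumes f: "f \<in> schwartz_pos"
  obtains L where "0 \<le> L" "\<And>x y. \<bar>f x - f y\<bar> \<le> L * \<bar>x - y\<bar>"
proof -
  obtain L where L: "0 \<le> L" "\<And>x. \<bar>deriv f x\<bar> \<le> L"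
    using schwartz_pos_bounded[OF schwartz_pos_deriv[OF f]] by metis
  have "norm (f x - f y) \<le> L * norm (x - y)" for x y
    by (rule field_differentiable_bound[of UNIV f "deriv f"])
       (use L schwartz_pos_DERIV[OF f] in auto)
  then show ?thesis using that L by simp
qed

text \<open>Differentiation under the integral sign, by dominated convergence: since \<open>f\<close> is Lipschitz, the
difference quotients of \<open>t \<mapsto> f (t / y)\<close> are bounded by a multiple of \<open>1 / y\<close>.  The result is
again a convolution of two elements of \<^const>\<open>schwartz_pos\<close>, which is what the coinductive membership proof needs.\<close>

lemma mellin_conv_DERIV:
  assumes f: "f \<in> schwartz_pos" and g: "g \<in> schwartz_pos"
  shows "(mellin_conv f g has_real_derivative mellin_conv (deriv f) (\<lambda>y. inverse y * g y) x) (at x)"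
proof -
  let ?G = "\<lambda>y. inverse y * g y"
  have G: "?G \<in> schwartz_pos" by (rule schwartz_pos_inverse_mult[OF g])
  have GG: "(\<lambda>y. inverse y * ?G y) \<in> schwartz_pos" by (rule schwartz_pos_inverse_mult[OF G])
  obtain L where L: "0 \<le> L" "\<And>x y. \<bar>f x - f y\<bar> \<le> L * \<bar>x - y\<bar>"
    using schwartz_pos_lipschitz[OF f] by metis
  have [measurable]: "f \<in> borel_measurable borel" "g \<in> borel_measurable borel"
     "deriv f \<in> borel_measurable borel"
    using f g schwartz_pos_deriv schwartz_pos_measurable by auto
  show ?thesis
    unfolding has_field_derivative_iff tendsto_at_iff_sequentially comp_def
  proof (intro allI impI)
    fix z :: "nat \<Rightarrow> real"
    assume z0: "\<forall>i. z i \<in> UNIV - {x}" and z: "z \<longlonglongrightarrow> x"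
    show "(\<lambda>n. (mellin_conv f g (z n) - mellin_conv f g x) / (z n - x))
        \<longlonglongrightarrow> mellin_conv (deriv f) ?G x"
    proof -
      let ?q = "\<lambda>n y. (f (z n * inverse y) - f (x * inverse y)) / (z n - x) * ?G y"
      have eq: "(mellin_conv f g (z n) - mellin_conv f g x) / (z n - x) = (\<integral>y. ?q n y \<partial>lborel)" for n
      proof -
        have "(mellin_conv f g (z n) - mellin_conv f g x) / (z n - x) =
          (\<integral>y. (inverse y * f (z n * inverse y) * g y - inverse y * f (x * inverse y) * g y) / (z n - x) \<partial>lborel)"
          unfolding mellin_conv_eq_integral[OF f g]
          by (simp add: Bochner_Integration.integral_diff integrable_mellin_conv f g)
        also have "\<dots> = (\<integral>y. ?q n y \<partial>lborel)"
          by (intro Bochner_Integration.integral_cong) (auto simp: algebra_simps diff_divide_distrib)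
        finally show ?thesis .
      qed
      have "(\<lambda>n. \<integral>y. ?q n y \<partial>lborel) \<longlonglongrightarrow> (\<integral>y. inverse y * deriv f (x * inverse y) * ?G y \<partial>lborel)"
      proof (rule integral_dominated_convergence)
        show "integrable lborel (\<lambda>y. L * \<bar>inverse y * ?G y\<bar>)"
          by (intro integrable_mult_right integrable_abs schwartz_pos_integrable GG)
        show "AE y in lborel. norm (?q n y) \<le> L * \<bar>inverse y * ?G y\<bar>" for n
        proof (intro AE_I2)
          fix y
          have "\<bar>f (z n * inverse y) - f (x * inverse y)\<bar> \<le> L * \<bar>(z n - x) * inverse y\<bar>"
            using L(2)[of "z n * inverse y" "x * inverse y"] by (simp add: algebra_simps)
          then have "\<bar>(f (z n * inverse y) - f (x * inverse y)) / (z n - x)\<bar> \<le> L * \<bar>inverse y\<bar>"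
            using z0 by (simp add: abs_mult pos_divide_le_eq mult_ac)
          then have "\<bar>(f (z n * inverse y) - f (x * inverse y)) / (z n - x)\<bar> * \<bar>?G y\<bar> \<le> L * \<bar>inverse y\<bar> * \<bar>?G y\<bar>"
            by (rule mult_right_mono) simp
          then show "norm (?q n y) \<le> L * \<bar>inverse y * ?G y\<bar>"
            by (simp only: abs_mult real_norm_def mult.assoc)
        qed
        show "AE y in lborel. (\<lambda>n. ?q n y) \<longlonglongrightarrow> inverse y * deriv f (x * inverse y) * ?G y"
        proof (intro AE_I2 tendsto_mult tendsto_const)
          fix y
          have "((\<lambda>t. f (t * inverse y)) has_real_derivative deriv f (x * inverse y) * inverse y) (at x)"
            by (rule DERIV_chain'[OF _ schwartz_pos_DERIV[OF f], THEN DERIV_cong])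
               (auto intro!: derivative_eq_intros)
          then have "(\<lambda>n. (f (z n * inverse y) - f (x * inverse y)) / (z n - x)) \<longlonglongrightarrow> deriv f (x * inverse y) * inverse y"
            unfolding has_field_derivative_iff tendsto_at_iff_sequentially comp_def
            using z0 z by simp
          then show "(\<lambda>n. (f (z n * inverse y) - f (x * inverse y)) / (z n - x)) \<longlonglongrightarrow> inverse y * deriv f (x * inverse y)"
            by (simp only: mult.commute)
        qed
      qed measurable
      then show ?thesis
        unfolding eq mellin_conv_eq_integral[OF schwartz_pos_deriv[OF f] G] .
    qed
  qed
qed

lemma mellin_conv_schwartz_pos:
  assumes "f \<in> schwartz_pos" "g \<in> schwartz_pos"
  shows "mellin_conv f g \<in> schwartz_pos"
proof (rule schwartz_pos_coinduct)
  let ?F = "{mellin_conv f g | f g. f \<in> schwartz_pos \<and> g \<in> schwartz_pos}"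
  show "mellin_conv f g \<in> ?F" using assms by auto
  fix h x assume "h \<in> ?F"
  then obtain f g where h: "h = mellin_conv f g" and fg: "f \<in> schwartz_pos" "g \<in> schwartz_pos"
    by auto
  show "rapid h" unfolding h by (rule rapid_mellin_conv[OF fg])
  note D = mellin_conv_DERIV[OF fg]
  show "h differentiable at x"
    unfolding h real_differentiable_def using D by (rule exI)
  have "deriv h = mellin_conv (deriv f) (\<lambda>y. inverse y * g y)"
    unfolding h using DERIV_imp_deriv[OF D] by (rule ext)
  then show "deriv h \<in> ?F"
    using schwartz_pos_deriv[OF fg(1)] schwartz_pos_inverse_mult[OF fg(2)] by auto
qed

lemma integral_dilation:
  fixes f :: "real \<Rightarrow> real"
  assumes "0 < y"
  shows "inverse y * (\<integral>x. f (x * inverse y) \<partial>lborel) = (\<integral>x. f x \<partial>lborel)"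
  using assms lborel_integral_real_affine[of "inverse y" f 0] by (simp add: mult.commute)

text \<open>By Fubini, since the dilation \<open>x \<mapsto> f (x / y)\<close> has \<open>y\<close> times the integral of \<open>f\<close>.\<close>

lemma integral_mellin_conv:
  assumes f: "f \<in> schwartz_pos" and g: "g \<in> schwartz_pos"
  shows "(\<integral>x. mellin_conv f g x \<partial>lborel) = (\<integral>x. f x \<partial>lborel) * (\<integral>x. g x \<partial>lborel)"
proof -
  let ?k = "\<lambda>y x. inverse y * f (x * inverse y) * g y"
  have [measurable]: "f \<in> borel_measurable borel" "g \<in> borel_measurable borel"
    using f g schwartz_pos_measurable by auto
  have dil: "(\<integral>x. inverse y * \<phi> (x * inverse y) * c \<partial>lborel) = (\<integral>x. \<phi> x \<partial>lborel) * c"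
    if "0 < y" for y c and \<phi> :: "real \<Rightarrow> real"
    using integral_dilation[OF that, of \<phi>] by simp
  have inner: "(\<integral>x. ?k y x \<partial>lborel) = (\<integral>x. f x \<partial>lborel) * g y" for y
    by (cases "0 < y") (simp_all only: dil, simp add: schwartz_pos_nonpos[OF g])
  have inner_abs: "(\<integral>x. norm (?k y x) \<partial>lborel) = (\<integral>x. \<bar>f x\<bar> \<partial>lborel) * \<bar>g y\<bar>" for y
  proof (cases "0 < y")
    case True
    then have "norm (?k y x) = inverse y * \<bar>f (x * inverse y)\<bar> * \<bar>g y\<bar>" for x
      by (simp add: abs_mult)
    then show ?thesis by (simp only: dil[OF True, of "\<lambda>x. \<bar>f x\<bar>"])
  qed (simp add: schwartz_pos_nonpos[OF g])
  have "integrable (lborel \<Otimes>\<^sub>M lborel) (case_prod ?k)"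
  proof (rule lborel_pair.Fubini_integrable)
    show "integrable lborel (\<lambda>y. \<integral>x. norm (case_prod ?k (y, x)) \<partial>lborel)"
      unfolding prod.case inner_abs
      by (intro integrable_mult_right integrable_abs schwartz_pos_integrable g)
    show "AE y in lborel. integrable lborel (\<lambda>x. case_prod ?k (y, x))"
    proof (intro AE_I2)
      fix y
      show "integrable lborel (\<lambda>x. case_prod ?k (y, x))"
      proof (cases "0 < y")
        case True
        then have "integrable lborel (\<lambda>x. f (0 + inverse y * x))"
          by (intro lborel_integrable_real_affine schwartz_pos_integrable f) simp
        then show ?thesis by (simp add: mult.commute)
      qed (simp add: schwartz_pos_nonpos[OF g])
    qed
  qed measurable
  from lborel_pair.Fubini_integral[OF this]
  have "(\<integral>x. (\<integral>y. ?k y x \<partial>lborel) \<partial>lborel) = (\<integral>y. (\<integral>x. f x \<partial>lborel) * g y \<partial>lborel)"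
    unfolding inner .
  then show ?thesis
    unfolding mellin_conv_eq_integral[OF f g] by simp
qed

lemma mellin_mellin_conv:
  assumes f: "f \<in> schwartz_pos" and g: "g \<in> schwartz_pos"
  shows "mellin s (mellin_conv f g) = mellin s f * mellin s g"
proof -
  have "mellin s (mellin_conv f g) = (\<integral>x. x powr (s - 1) * mellin_conv f g x \<partial>lborel)"
    by (rule mellin_eq_integral[OF mellin_conv_schwartz_pos[OF f g]])
  also have "\<dots> = (\<integral>x. x powr (s - 1) * f x \<partial>lborel) * (\<integral>x. x powr (s - 1) * g x \<partial>lborel)"
    unfolding mellin_conv_powr_mult[OF f g, symmetric]
    by (rule integral_mellin_conv) (intro schwartz_pos_powr_mult f g)+
  finally show ?thesis by (simp add: mellin_eq_integral f g)
qed

section \<open>The Euler operator\<close>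

text \<open>The infinitesimal generator of the dilations, that is, the invariant vector field of the
multiplicative group of positive reals.\<close>

definition euler_deriv :: "(real \<Rightarrow> real) \<Rightarrow> real \<Rightarrow> real" where
  "euler_deriv f x = x * deriv f x"

lemma deriv_schwartz_pos_nonpos: "f \<in> schwartz_pos \<Longrightarrow> x \<le> 0 \<Longrightarrow> deriv f x = 0"
  by (intro schwartz_pos_nonpos schwartz_pos_deriv)

lemma euler_deriv_schwartz_pos:
  assumes f: "f \<in> schwartz_pos"
  shows "euler_deriv f \<in> schwartz_pos"
proof -
  have "(\<lambda>x. x powr 1 * deriv f x) = euler_deriv f"
  proof
    fix x show "x powr 1 * deriv f x = euler_deriv f x"
      by (cases "0 < x") (simp_all add: euler_deriv_def deriv_schwartz_pos_nonpos[OF f])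
  qed
  then show ?thesis using schwartz_pos_powr_mult[OF schwartz_pos_deriv[OF f], of 1] by simp
qed

text \<open>The Euler operator can be moved from one factor of a convolution to the other.  The two integrands
differ by the derivative of \<open>f (x / y) * g y\<close> in \<open>y\<close>, whose integral is zero.\<close>

lemma mellin_conv_euler_deriv_swap:
  assumes f: "f \<in> schwartz_pos" and g: "g \<in> schwartz_pos"
  shows "mellin_conv (euler_deriv f) g = mellin_conv f (euler_deriv g)"
proof
  fix x
  show "mellin_conv (euler_deriv f) g x = mellin_conv f (euler_deriv g) x"
  proof (cases "0 < x")
    case True
    let ?h = "\<lambda>y. f (x * inverse y) * g y"
    let ?h' = "\<lambda>y. inverse y * f (x * inverse y) * euler_deriv g y
       - inverse y * euler_deriv f (x * inverse y) * g y"
    obtain C where C: "0 \<le> C" "\<And>x. \<bar>f x\<bar> \<le> C" using schwartz_pos_bounded[OF f] by metis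
    have "(\<integral>y. ?h' y \<partial>lborel) = 0"
    proof (rule integral_derivative_rapid)
      show "rapid ?h" unfolding rapid_def
      proof (intro conjI allI)
        fix t
        obtain D where D: "\<And>x. x > 0 \<Longrightarrow> x powr t * \<bar>g x\<bar> \<le> D"
          using rapid_bound[OF schwartz_pos_rapid[OF g]] by metis
        have "y powr t * \<bar>?h y\<bar> \<le> C * D" if "0 < y" for y
          using mult_mono[OF C(2)[of "x * inverse y"] D[OF that] C(1)] by (simp add: abs_mult mult_ac)
        then show "\<exists>C. \<forall>y>0. y powr t * \<bar>?h y\<bar> \<le> C" by blast
      qed (simp add: schwartz_pos_nonpos[OF g])
      show "integrable lborel ?h'"
        by (intro Bochner_Integration.integrable_diff integrable_mellin_conv euler_deriv_schwartz_pos f g)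
      show "?h' y = 0" if "y \<le> 0" for y
        using that by (simp add: schwartz_pos_nonpos[OF g] schwartz_pos_nonpos[OF euler_deriv_schwartz_pos[OF g]])
      fix y :: real assume y: "0 < y"
      have inv: "((\<lambda>y. x * inverse y) has_real_derivative - x * inverse y * inverse y) (at y)"
        using y by (auto intro!: derivative_eq_intros simp: power2_eq_square field_simps)
      have "(?h has_real_derivative
         f (x * inverse y) * deriv g y + deriv f (x * inverse y) * (- x * inverse y * inverse y) * g y) (at y)"
        by (intro DERIV_mult' schwartz_pos_DERIV[OF g] DERIV_chain2[OF schwartz_pos_DERIV[OF f] inv])
      then show "(?h has_real_derivative ?h' y) (at y)"
        using y by (elim DERIV_cong) (simp add: euler_deriv_def)
      have inv': "isCont (\<lambda>y. x * inverse y) y" using inv by (rule DERIV_isCont)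
      show "isCont ?h' y"
        using y by (intro continuous_intros isCont_o2[OF inv'] schwartz_pos_continuous euler_deriv_schwartz_pos f g) simp_all
    qed
    then show ?thesis
      by (simp add: mellin_conv_eq_integral euler_deriv_schwartz_pos f g integrable_mellin_conv
          Bochner_Integration.integral_diff)
  qed (simp add: mellin_conv_def)
qed

lemma mellin_euler_deriv:
  assumes f: "f \<in> schwartz_pos"
  shows "mellin s (euler_deriv f) = - s * mellin s f"
proof -
  let ?h = "\<lambda>x. x powr s * f x"
  have h: "?h \<in> schwartz_pos" by (rule schwartz_pos_powr_mult[OF f])
  have deriv: "deriv ?h x = s * (x powr (s - 1) * f x) + x powr (s - 1) * euler_deriv f x" for x
  proof (cases "0 < x")
    case True
    have "(?h has_real_derivative s * (x powr (s - 1) * f x) + x powr (s - 1) * euler_deriv f x) (at x)"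
      using True by (auto intro!: derivative_eq_intros schwartz_pos_DERIV[OF f]
          simp: euler_deriv_def powr_diff)
    then show ?thesis by (rule DERIV_imp_deriv)
  qed (simp add: deriv_schwartz_pos_nonpos[OF h] schwartz_pos_nonpos[OF f] euler_deriv_def
        deriv_schwartz_pos_nonpos[OF f])
  have "0 = (\<integral>x. deriv ?h x \<partial>lborel)" using integral_deriv_schwartz_pos[OF h] by simp
  also have "\<dots> = s * mellin s f + mellin s (euler_deriv f)"
    unfolding deriv
    by (simp add: mellin_eq_integral f euler_deriv_schwartz_pos schwartz_pos_integrable schwartz_pos_powr_mult
        Bochner_Integration.integral_add)
  finally show ?thesis by simp
qed

text \<open>The kernel of the functional \<open>mellin s\<close> is the range of the Euler operator shifted by \<open>s\<close>.  The
first-order equation \<open>x f' + s f = g\<close> has the integrating factor \<open>x powr s\<close>: its solution is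
\<open>f = x powr (- s) * F\<close> with \<open>F' = x powr (s - 1) * g\<close>, and the hypothesis on \<open>g\<close> is exactly what
makes \<open>F\<close> decay at infinity.\<close>

lemma mellin_zero_imp_euler_image:
  assumes g: "g \<in> schwartz_pos" and zero: "mellin s g = 0"
  obtains f where "f \<in> schwartz_pos" "g = (\<lambda>x. euler_deriv f x + s * f x)"
proof -
  obtain F where F: "F \<in> schwartz_pos" and dF: "\<And>x. (F has_real_derivative x powr (s - 1) * g x) (at x)"
    using schwartz_pos_primitive[OF schwartz_pos_powr_mult[OF g]] zero mellin_eq_integral[OF g] by metis
  let ?f = "\<lambda>x. x powr (- s) * F x"
  have f: "?f \<in> schwartz_pos" by (rule schwartz_pos_powr_mult[OF F])
  have "g x = euler_deriv ?f x + s * ?f x" for x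
  proof (cases "0 < x")
    case True
    have "(?f has_real_derivative - s * x powr (- s - 1) * F x + x powr (- s) * (x powr (s - 1) * g x)) (at x)"
      using True by (auto intro!: derivative_eq_intros dF)
    then have "deriv ?f x = - s * x powr (- s - 1) * F x + x powr (- s) * (x powr (s - 1) * g x)"
      by (rule DERIV_imp_deriv)
    then show ?thesis
      using True by (simp add: euler_deriv_def powr_diff powr_minus field_simps)
  qed (simp add: schwartz_pos_nonpos[OF g] schwartz_pos_nonpos[OF F] euler_deriv_def deriv_schwartz_pos_nonpos[OF f])
  then show ?thesis using that[OF f] by blast
qed

section \<open>The Mellin functionals are characters\<close>

lemma mellin_add:
  "f \<in> schwartz_pos \<Longrightarrow> g \<in> schwartz_pos \<Longrightarrow> mellin s (\<lambda>x. f x + g x) = mellin s f + mellin s g"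
  by (simp add: mellin_eq_integral schwartz_pos_add distrib_left Bochner_Integration.integral_add
      schwartz_pos_integrable schwartz_pos_powr_mult)

lemma mellin_scale:
  assumes "f \<in> schwartz_pos"
  shows "mellin s (\<lambda>x. c * f x) = c * mellin s f"
proof -
  have "x powr (s - 1) * (c * f x) = c * (x powr (s - 1) * f x)" for x by simp
  then show ?thesis
    by (simp only: mellin_eq_integral assms schwartz_pos_scale integral_mult_right_zero)
qed

lemma seminorm_upper:
  assumes "f \<in> schwartz_pos" "0 < x"
  shows "x powi \<alpha> * \<bar>f x\<bar> \<le> schwartz_pos_seminorm \<alpha> 0 f"
  unfolding schwartz_pos_seminorm_def
  using cSUP_upper[OF _ schwartz_pos_bdd[OF assms(1), of \<alpha> 0], of x] assms(2)
  by (simp add: abs_mult)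

text \<open>The exponent \<open>s - 1\<close> is squeezed between its two neighbouring integers, and each of them also
appears increased by \<open>2\<close>, because integrability is obtained from quadratic decay.  When \<open>s\<close> is an
integer, the index set has a single element.\<close>

lemma abs_mellin_le_seminorms:
  assumes f: "f \<in> schwartz_pos"
  shows "\<bar>mellin s f\<bar> \<le> (\<Sum>\<alpha>\<in>{\<lfloor>s\<rfloor> - 1, \<lceil>s\<rceil> - 1}. schwartz_pos_seminorm \<alpha> 0 f
     + schwartz_pos_seminorm (\<alpha> + 2) 0 f) * kernel_mass"
  unfolding mellin_eq_integral[OF f]
proof (rule integral_quadratic_decay_le)
  have h: "(\<lambda>x. x powr (s - 1) * f x) \<in> schwartz_pos" by (rule schwartz_pos_powr_mult[OF f])
  show "(\<lambda>x. x powr (s - 1) * f x) \<in> borel_measurable borel"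
    by (rule schwartz_pos_measurable[OF h])
  show "x powr (s - 1) * f x = 0" if "x \<le> 0" for x
    using that by (rule schwartz_pos_nonpos[OF h])
  fix x :: real assume x: "0 < x"
  have "x powr (s - 1) \<le> (\<Sum>\<alpha>\<in>{\<lfloor>s\<rfloor> - 1, \<lceil>s\<rceil> - 1}. x powr of_int \<alpha>)"
  proof (cases "\<lfloor>s\<rfloor> = \<lceil>s\<rceil>")
    case True
    then have "s = of_int \<lfloor>s\<rfloor>" by (metis le_of_int_ceiling of_int_floor_le order_antisym)
    then have "s - 1 = of_int (\<lfloor>s\<rfloor> - 1)" by simp
    then show ?thesis using True by simp
  next
    case False
    then show ?thesis
      using powr_le_sum[of "of_int (\<lfloor>s\<rfloor> - 1)" "s - 1" "of_int (\<lceil>s\<rceil> - 1)" x] x by simp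
  qed
  then have "(1 + x\<^sup>2) * \<bar>x powr (s - 1) * f x\<bar>
     \<le> (1 + x\<^sup>2) * ((\<Sum>\<alpha>\<in>{\<lfloor>s\<rfloor> - 1, \<lceil>s\<rceil> - 1}. x powr of_int \<alpha>) * \<bar>f x\<bar>)"
    by (auto simp: abs_mult intro!: mult_left_mono mult_right_mono)
  also have "\<dots> = (\<Sum>\<alpha>\<in>{\<lfloor>s\<rfloor> - 1, \<lceil>s\<rceil> - 1}. x powi \<alpha> * \<bar>f x\<bar> + x powi (\<alpha> + 2) * \<bar>f x\<bar>)"
    using x unfolding sum_distrib_left sum_distrib_right
    by (intro sum.cong) (auto simp: powr_real_of_int' power_int_add algebra_simps)
  also have "\<dots> \<le> (\<Sum>\<alpha>\<in>{\<lfloor>s\<rfloor> - 1, \<lceil>s\<rceil> - 1}. schwartz_pos_seminorm \<alpha> 0 f + schwartz_pos_seminorm (\<alpha> + 2) 0 f)"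
    by (intro sum_mono add_mono seminorm_upper f x)
  finally show "(1 + x\<^sup>2) * \<bar>x powr (s - 1) * f x\<bar> \<le> \<dots>" .
qed

lemma openin_seminorm_ball:
  assumes "f \<in> schwartz_pos" "0 < e"
  shows "openin schwartz_pos_topology {g \<in> schwartz_pos. schwartz_pos_seminorm \<alpha> \<beta> (\<lambda>x. g x - f x) < e}"
  unfolding schwartz_pos_topology_def
  by (rule topology_generated_by_Basis) (use assms in blast)

lemma seminorm_zero: "schwartz_pos_seminorm \<alpha> \<beta> (\<lambda>x. f x - f x) = 0"
proof -
  have "(deriv ^^ \<beta>) (\<lambda>x. 0::real) = (\<lambda>x. 0)" by (induction \<beta>) auto
  then show ?thesis by (simp add: schwartz_pos_seminorm_def)
qed

lemma continuous_map_mellin: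
  "continuous_map schwartz_pos_topology euclideanreal (restrict (mellin s) schwartz_pos)"
  unfolding continuous_map_def topspace_schwartz_pos_topology
proof (intro conjI allI impI)
  fix V :: "real set" assume "openin euclidean V"
  then have V: "open V" by simp
  show "openin schwartz_pos_topology {f \<in> schwartz_pos. restrict (mellin s) schwartz_pos f \<in> V}"
  proof (subst openin_subopen, intro ballI)
    fix f assume "f \<in> {f \<in> schwartz_pos. restrict (mellin s) schwartz_pos f \<in> V}"
    then have f: "f \<in> schwartz_pos" and fV: "mellin s f \<in> V" by auto
    obtain e where e: "0 < e" "\<And>r. \<bar>r - mellin s f\<bar> < e \<Longrightarrow> r \<in> V"
      using V fV unfolding open_dist dist_real_def by metis
    \<comment> \<open>There are at most four seminorms below \<open>d\<close>; the excess in \<open>5\<close> and \<open>+ 1\<close> makes the estimate strict.\<close>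
    define d where "d = e / (5 * (kernel_mass + 1))"
    have d: "0 < d" "4 * d * kernel_mass < e"
      using e kernel_mass_nonneg
      by (auto simp: d_def field_simps intro: add_nonneg_pos)
    let ?A = "{\<lfloor>s\<rfloor> - 1, \<lceil>s\<rceil> - 1}"
    let ?B = "\<lambda>\<alpha>. {g \<in> schwartz_pos. schwartz_pos_seminorm \<alpha> 0 (\<lambda>x. g x - f x) < d}"
    define N where "N = (\<Inter>\<alpha>\<in>?A. ?B \<alpha> \<inter> ?B (\<alpha> + 2))"
    have "openin schwartz_pos_topology N"
      unfolding N_def by (intro openin_INT2 openin_Int openin_seminorm_ball f d) auto
    moreover have "f \<in> N" unfolding N_def using f d(1) by (simp only: seminorm_zero INT_iff IntI mem_Collect_eq simp_thms ball_simps)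
    moreover have "mellin s g \<in> V \<and> g \<in> schwartz_pos" if "g \<in> N" for g
    proof
      show g: "g \<in> schwartz_pos" using that unfolding N_def by auto
      have gf: "(\<lambda>x. g x - f x) \<in> schwartz_pos" by (rule schwartz_pos_diff[OF g f])
      have "mellin s g = mellin s (\<lambda>x. (g x - f x) + f x)" by simp
      also have "\<dots> = mellin s (\<lambda>x. g x - f x) + mellin s f" by (rule mellin_add[OF gf f])
      finally have eq: "mellin s g - mellin s f = mellin s (\<lambda>x. g x - f x)" by simp
      have "\<bar>mellin s (\<lambda>x. g x - f x)\<bar> \<le> (\<Sum>\<alpha>\<in>?A. schwartz_pos_seminorm \<alpha> 0 (\<lambda>x. g x - f x)
         + schwartz_pos_seminorm (\<alpha> + 2) 0 (\<lambda>x. g x - f x)) * kernel_mass"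
        by (rule abs_mellin_le_seminorms[OF gf])
      also have "\<dots> \<le> (\<Sum>\<alpha>\<in>?A. d + d) * kernel_mass"
        using that unfolding N_def
        by (intro mult_right_mono kernel_mass_nonneg sum_mono add_mono) auto
      also have "\<dots> \<le> (4 * d) * kernel_mass"
        using d(1) by (intro mult_right_mono kernel_mass_nonneg) (auto simp: card_insert_if)
      also have "\<dots> < e" by (rule d)
      finally show "mellin s g \<in> V" using e eq by simp
    qed
    ultimately show "\<exists>T. openin schwartz_pos_topology T \<and> f \<in> T \<and>
        T \<subseteq> {f \<in> schwartz_pos. restrict (mellin s) schwartz_pos f \<in> V}"
      by (intro exI[of _ N]) auto
  qed
qed auto

text \<open>The hypothesis keeps the functional from being zero; its proof is thereby left to the place where
an element of \<^const>\<open>schwartz_pos\<close> with nonzero Mellin integral is at hand.\<close>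

lemma restrict_mellin_in_structure_space:
  assumes "f \<in> schwartz_pos" "mellin s f \<noteq> 0"
  shows "restrict (mellin s) schwartz_pos \<in> mellin_structure_space"
  unfolding mellin_structure_space_def
  using assms continuous_map_mellin
  by (auto simp: schwartz_pos_add schwartz_pos_scale mellin_conv_schwartz_pos mellin_add mellin_scale
      mellin_mellin_conv)

section \<open>Every character is a Mellin functional\<close>

text \<open>Applied to \<open>mellin_conv_euler_deriv_swap\<close>, multiplicativity says that \<open>m (euler_deriv f) * m e\<close> is
symmetric in \<open>f\<close> and \<open>e\<close>.  So every \<open>f\<close> satisfies \<open>m (euler_deriv f) = - s * m f\<close> with one constant
\<open>s\<close>, and \<open>m\<close> vanishes on the range of the Euler operator shifted by \<open>s\<close>, which contains the kernel of
\<open>mellin s\<close>.  A functional that vanishes on the kernel of another one is a multiple of it, and as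
both are multiplicative and nonzero, the factor is \<open>1\<close>.\<close>

lemma structure_space_representation:
  assumes m: "m \<in> mellin_structure_space"
  obtains s where "m = restrict (mellin s) schwartz_pos"
proof -
  have ext: "m \<in> extensional schwartz_pos"
    and nz: "\<exists>f\<in>schwartz_pos. m f \<noteq> 0"
    and add: "\<And>f g. f \<in> schwartz_pos \<Longrightarrow> g \<in> schwartz_pos \<Longrightarrow> m (\<lambda>x. f x + g x) = m f + m g"
    and scale: "\<And>c f. f \<in> schwartz_pos \<Longrightarrow> m (\<lambda>x. c * f x) = c * m f"
    and mult: "\<And>f g. f \<in> schwartz_pos \<Longrightarrow> g \<in> schwartz_pos \<Longrightarrow> m (mellin_conv f g) = m f * m g"
    using m unfolding mellin_structure_space_def by blast+
  obtain e where e: "e \<in> schwartz_pos" "m e \<noteq> 0" using nz by blast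
  define s where "s = - m (euler_deriv e) / m e"
  have euler: "m (euler_deriv f) = - s * m f" if f: "f \<in> schwartz_pos" for f
  proof -
    have "m (euler_deriv f) * m e = m f * m (euler_deriv e)"
      using mult[OF euler_deriv_schwartz_pos[OF f] e(1)] mult[OF f euler_deriv_schwartz_pos[OF e(1)]]
        mellin_conv_euler_deriv_swap[OF f e(1)] by simp
    then show ?thesis using e(2) by (simp add: s_def field_simps)
  qed
  have kernel: "m g = 0" if g: "g \<in> schwartz_pos" "mellin s g = 0" for g
  proof -
    obtain f where f: "f \<in> schwartz_pos" "g = (\<lambda>x. euler_deriv f x + s * f x)"
      using mellin_zero_imp_euler_image[OF g] by metis
    have "m g = m (euler_deriv f) + m (\<lambda>x. s * f x)"
      unfolding f(2) by (rule add[OF euler_deriv_schwartz_pos[OF f(1)] schwartz_pos_scale[OF f(1)]])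
    then show ?thesis using euler[OF f(1)] scale[OF f(1)] by simp
  qed
  have me: "mellin s e \<noteq> 0" using kernel e by blast
  define c where "c = m e / mellin s e"
  have c0: "c \<noteq> 0" using e me by (simp add: c_def)
  have proportional: "m f = c * mellin s f" if f: "f \<in> schwartz_pos" for f
  proof -
    let ?a = "- (mellin s f / mellin s e)"
    have ae: "(\<lambda>x. ?a * e x) \<in> schwartz_pos" by (rule schwartz_pos_scale[OF e(1)])
    have "mellin s (\<lambda>x. f x + ?a * e x) = 0"
      by (simp only: mellin_add[OF f ae] mellin_scale[OF e(1)]) (simp add: me)
    then have "m (\<lambda>x. f x + ?a * e x) = 0" by (rule kernel[OF schwartz_pos_add[OF f ae]])
    then have "m f + ?a * m e = 0" by (simp only: add[OF f ae] scale[OF e(1)])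
    then show ?thesis by (simp add: c_def field_simps)
  qed
  have "c * (mellin s e * mellin s e) = (c * mellin s e) * (c * mellin s e)"
    using mult[OF e(1) e(1)] proportional[OF e(1)] proportional[OF mellin_conv_schwartz_pos[OF e(1) e(1)]]
      mellin_mellin_conv[OF e(1) e(1)] by simp
  then have "c = 1" using me c0 by simp
  have "m = restrict (mellin s) schwartz_pos"
  proof (rule extensionalityI[OF ext restrict_extensional])
    fix f assume "f \<in> schwartz_pos"
    then show "m f = restrict (mellin s) schwartz_pos f" using proportional \<open>c = 1\<close> by simp
  qed
  then show ?thesis by (rule that)
qed

text \<open>The exponent can be read off as the eigenvalue \<open>- s\<close> of the Euler operator.\<close>

lemma mellin_eq_imp_eq:
  assumes "f \<in> schwartz_pos" "mellin s f \<noteq> 0"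
    and "\<And>g. g \<in> schwartz_pos \<Longrightarrow> mellin s g = mellin t g"
  shows "s = t"
proof -
  have "- s * mellin s f = - t * mellin s f"
    using assms(3)[OF euler_deriv_schwartz_pos[OF assms(1)]] assms(3)[OF assms(1)]
    by (simp add: mellin_euler_deriv[OF assms(1)])
  then show ?thesis using assms(2) by simp
qed

lemma mellin_omega_restrict_mellin:
  assumes f: "f \<in> schwartz_pos" "mellin s f \<noteq> 0"
  shows "mellin_omega (restrict (mellin s) schwartz_pos) = s"
  unfolding mellin_omega_def mellin_def[symmetric]
proof (rule the_equality)
  fix t assume "\<forall>g\<in>schwartz_pos. restrict (mellin s) schwartz_pos g = mellin t g"
  then have "s = t" by (intro mellin_eq_imp_eq[OF f]) simp
  then show "t = s" by simp
qed simp

section \<open>Openness of the parametrization\<close>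

text \<open>Along a convergent sequence the exponents stay in some \<open>[-K, K]\<close>, and there the integrands are
dominated by the sum of those for the two extreme exponents.\<close>

lemma mellin_continuous:
  assumes f: "f \<in> schwartz_pos"
  shows "isCont (\<lambda>s. mellin s f) s"
  unfolding continuous_at_sequentially comp_def
proof (intro allI impI)
  fix z assume z: "z \<longlonglongrightarrow> s"
  then obtain K where K: "\<And>n. \<bar>z n\<bar> \<le> K"
    using convergent_imp_Bseq[OF convergentI[OF z]] unfolding Bseq_def by auto
  have [measurable]: "f \<in> borel_measurable borel" by (rule schwartz_pos_measurable[OF f])
  show "(\<lambda>n. mellin (z n) f) \<longlonglongrightarrow> mellin s f"
    unfolding mellin_eq_integral[OF f]
  proof (rule integral_dominated_convergence)
    show "integrable lborel (\<lambda>x. \<bar>x powr (- K - 1) * f x\<bar> + \<bar>x powr (K - 1) * f x\<bar>)"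
      by (intro Bochner_Integration.integrable_add integrable_abs schwartz_pos_integrable schwartz_pos_powr_mult f)
    show "AE x in lborel. norm (x powr (z n - 1) * f x) \<le> \<bar>x powr (- K - 1) * f x\<bar> + \<bar>x powr (K - 1) * f x\<bar>" for n
    proof (intro AE_I2)
      fix x
      show "norm (x powr (z n - 1) * f x) \<le> \<bar>x powr (- K - 1) * f x\<bar> + \<bar>x powr (K - 1) * f x\<bar>"
      proof (cases "0 < x")
        case True
        have "x powr (z n - 1) \<le> x powr (- K - 1) + x powr (K - 1)"
          using K[of n] True by (intro powr_le_sum) auto
        then show ?thesis
          by (simp add: abs_mult mult_right_mono flip: distrib_right)
      qed (simp add: schwartz_pos_nonpos[OF f])
    qed
    show "AE x in lborel. (\<lambda>n. x powr (z n - 1) * f x) \<longlonglongrightarrow> x powr (s - 1) * f x"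
    proof (intro AE_I2)
      fix x
      show "(\<lambda>n. x powr (z n - 1) * f x) \<longlonglongrightarrow> x powr (s - 1) * f x"
      proof (cases "0 < x")
        case True
        then show ?thesis by (intro tendsto_intros z) auto
      qed (simp add: schwartz_pos_nonpos[OF f])
    qed
  qed measurable
qed

theorem theorem18:
  shows "open_map mellin_weak_star euclideanreal mellin_omega"
  unfolding open_map_def
proof (intro allI impI)
  fix U assume U: "openin mellin_weak_star U"
  then have sub: "U \<subseteq> mellin_structure_space"
    using openin_subset topspace_mellin_weak_star by blast
  show "openin euclideanreal (mellin_omega ` U)"
  proof (cases "U = {}")
    case False
    then obtain m where m: "m \<in> mellin_structure_space" using sub by blast
    then obtain f where f: "f \<in> schwartz_pos" "m f \<noteq> 0"
      unfolding mellin_structure_space_def by blast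
    obtain s0 where "m = restrict (mellin s0) schwartz_pos"
      using m by (rule structure_space_representation)
    then have s0: "mellin s0 f \<noteq> 0" using f by simp
    \<comment> \<open>The character \<open>m\<close> supplies a function with nonzero Mellin integral at one exponent \<open>s0\<close>.
        A power of \<open>x\<close> carries it to any other exponent \<open>s\<close>.\<close>
    have nz: "(\<lambda>x. x powr (s0 - s) * f x) \<in> schwartz_pos" "mellin s (\<lambda>x. x powr (s0 - s) * f x) \<noteq> 0" for s
    proof -
      show h: "(\<lambda>x. x powr (s0 - s) * f x) \<in> schwartz_pos" by (rule schwartz_pos_powr_mult[OF f(1)])
      have eq: "x powr (s - 1) * (x powr (s0 - s) * f x) = x powr (s0 - 1) * f x" for x
        by (simp flip: powr_add mult.assoc)
      then show "mellin s (\<lambda>x. x powr (s0 - s) * f x) \<noteq> 0"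
        using s0 by (simp only: mellin_eq_integral[OF h] eq mellin_eq_integral[OF f(1)] not_False_eq_True)
    qed
    \<comment> \<open>\<open>?\<phi>\<close> is the inverse of \<^const>\<open>mellin_omega\<close>, so the image of \<open>U\<close> is its preimage under \<open>?\<phi>\<close>.\<close>
    let ?\<phi> = "\<lambda>s. restrict (mellin s) schwartz_pos"
    have mem: "?\<phi> s \<in> mellin_structure_space" for s
      by (rule restrict_mellin_in_structure_space[OF nz])
    have omega: "mellin_omega (?\<phi> s) = s" for s
      by (rule mellin_omega_restrict_mellin[OF nz])
    have "continuous_map euclideanreal mellin_weak_star ?\<phi>"
      unfolding mellin_weak_star_def
    proof (rule continuous_on_generated_topo)
      fix W assume "W \<in> {{m \<in> mellin_structure_space. m f \<in> V} | f V. f \<in> schwartz_pos \<and> open V}"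
      then obtain g V where W: "W = {m \<in> mellin_structure_space. m g \<in> V}" "g \<in> schwartz_pos" "open V"
        by blast
      have "?\<phi> -` W \<inter> topspace euclideanreal = (\<lambda>s. mellin s g) -` V"
        using mem W by auto
      moreover have "open ((\<lambda>s. mellin s g) -` V)"
        using W mellin_continuous by (intro continuous_open_vimage) (auto simp: continuous_on_eq_continuous_at)
      ultimately show "openin euclideanreal (?\<phi> -` W \<inter> topspace euclideanreal)" by simp
    next
      show "?\<phi> ` topspace euclideanreal \<subseteq> \<Union> {{m \<in> mellin_structure_space. m f \<in> V} | f V. f \<in> schwartz_pos \<and> open V}"
        using mem topspace_mellin_weak_star
        unfolding mellin_weak_star_def topology_generated_by_topspace by auto
    qed
    from openin_continuous_map_preimage[OF this U]
    have "open {s. ?\<phi> s \<in> U}" by simp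
    moreover have "mellin_omega ` U = {s. ?\<phi> s \<in> U}"
    proof (intro set_eqI iffI)
      fix s assume "s \<in> mellin_omega ` U"
      then obtain m where m: "m \<in> U" "s = mellin_omega m" by blast
      have "m \<in> mellin_structure_space" using sub m(1) by blast
      then obtain t where t: "m = ?\<phi> t" by (rule structure_space_representation)
      then show "s \<in> {s. ?\<phi> s \<in> U}" using m omega[of t] by simp
    next
      fix s assume "s \<in> {s. ?\<phi> s \<in> U}"
      then have "mellin_omega (?\<phi> s) \<in> mellin_omega ` U" by blast
      then show "s \<in> mellin_omega ` U" by (simp only: omega)
    qed
    ultimately show ?thesis by simp
  qed simp
qed

end
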